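(* Let $X$ be non-empty and let $(X,\mathcal{T}_1,\mathcal{T}_2,E)$ be a bi-soft topological space over $X$. Suppose that for all $x,y\in X$ with $x\neq y$ there exists a $\mathcal{T}_1$-soft open set $(F,E)$ such that $x\in(F,E)$ and $y\in(F,E)^c$, or there exists a $\mathcal{T}_2$-soft open set $(G,E)$ such that $y\in(G,E)$ and $x\in(G,E)^c$. Then $(X,\mathcal{T}_1,\mathcal{T}_2,E)$ is a pair-wise soft $T_0$-space over $X$, and $(X,\mathcal{T}_{1e},\mathcal{T}_{2e})$ is a pair-wise $T_0$-space for each $e\in E$.
   Context: $X$ is the initial universe and $E$ is a non-empty set of parameters. A soft set $(F,E)$ over $X$ is a map $F:E\to\mathcal{P}(X)$, where $\mathcal{P}(X)$ is the power set of $X$. Unions, intersections and complements of soft sets are taken parameterwise; in particular $(F,E)^c$ has value $X-F(e)$ at each $e\in E$. $\Phi$ denotes the soft set with value $\emptyset$ at every $e\in E$ and $\widetilde{X}$ the soft set with value $X$ at every $e\in E$. For $x\in X$, $x\in(F,E)$ means $x\in F(e)$ for all $e\in E$ (so $x\notin(F,E)$ means $x\notin F(e)$ for some $e\in E$). A soft topology on $X$ is a collection $\mathcal{T}$ of soft sets over $X$ (with parameter set $E$) containing $\Phi$ and $\widetilde{X}$ and closed under arbitrary unions and under intersections of two members; its members are called soft open. A bi-soft topological space $(X,\mathcal{T}_1,\mathcal{T}_2,E)$ consists of two soft topologies $\mathcal{T}_1,\mathcal{T}_2$ on $X$ with the same parameter set $E$. For $e\in E$ and $i=1,2$, $\mathcal{T}_{ie}=\{F(e)\mid(F,E)\in\mathcal{T}_i\}$,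 which is a topology on $X$. A bitopological space is a non-empty set with two topologies. $(X,\mathcal{T}_1,\mathcal{T}_2,E)$ is a pair-wise soft $T_0$-space if for every two distinct points of $X$ there is a $\mathcal{T}_1$-soft open set or a $\mathcal{T}_2$-soft open set which contains one of the two points but not the other. A bitopological space $(X,\mathcal{P},\mathcal{Q})$ is pair-wise $T_0$ if for each pair of distinct points of $X$ there is a $\mathcal{P}$-open set or a $\mathcal{Q}$-open set containing one of the points but not the other. *)

theory Defs
  imports "HOL-Analysis.Abstract_Topology" "HOL-Library.FuncSet"
begin

(* A soft set (F,E) over X is a map E -> Pow X. Being extensional (undefined outside E),
   two soft sets are equal as HOL functions iff they agree on E. *)
definition soft_sets :: "'a set \<Rightarrow> 'e set \<Rightarrow> ('e \<Rightarrow> 'a set) set" where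
  "soft_sets X E = (E \<rightarrow>\<^sub>E Pow X)"

definition soft_null :: "'e set \<Rightarrow> 'e \<Rightarrow> 'a set" where
  "soft_null E = (\<lambda>e\<in>E. {})"

definition soft_absolute :: "'a set \<Rightarrow> 'e set \<Rightarrow> 'e \<Rightarrow> 'a set" where
  "soft_absolute X E = (\<lambda>e\<in>E. X)"

definition soft_Union :: "'e set \<Rightarrow> ('e \<Rightarrow> 'a set) set \<Rightarrow> 'e \<Rightarrow> 'a set" where
  "soft_Union E S = (\<lambda>e\<in>E. \<Union>F\<in>S. F e)"

definition soft_inter :: "'e set \<Rightarrow> ('e \<Rightarrow> 'a set) \<Rightarrow> ('e \<Rightarrow> 'a set) \<Rightarrow> 'e \<Rightarrow> 'a set" where
  "soft_inter E F G = (\<lambda>e\<in>E. F e \<inter> G e)"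

definition soft_compl :: "'a set \<Rightarrow> 'e set \<Rightarrow> ('e \<Rightarrow> 'a set) \<Rightarrow> 'e \<Rightarrow> 'a set" where
  "soft_compl X E F = (\<lambda>e\<in>E. X - F e)"

(* Membership is required at every parameter, so its negation is failure at some parameter,
   which is weaker than membership in the soft complement. *)
definition soft_mem :: "'e set \<Rightarrow> 'a \<Rightarrow> ('e \<Rightarrow> 'a set) \<Rightarrow> bool" where
  "soft_mem E x F \<longleftrightarrow> (\<forall>e\<in>E. x \<in> F e)"

definition soft_topology :: "'a set \<Rightarrow> 'e set \<Rightarrow> ('e \<Rightarrow> 'a set) set \<Rightarrow> bool" where
  "soft_topology X E T \<longleftrightarrow>
     T \<subseteq> soft_sets X E \<and>
     soft_null E \<in> T \<and> soft_absolute X E \<in> T \<and>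
     (\<forall>S\<subseteq>T. soft_Union E S \<in> T) \<and>
     (\<forall>F\<in>T. \<forall>G\<in>T. soft_inter E F G \<in> T)"

definition bi_soft_topological_space ::
    "'a set \<Rightarrow> ('e \<Rightarrow> 'a set) set \<Rightarrow> ('e \<Rightarrow> 'a set) set \<Rightarrow> 'e set \<Rightarrow> bool" where
  "bi_soft_topological_space X T1 T2 E \<longleftrightarrow> soft_topology X E T1 \<and> soft_topology X E T2"

definition pairwise_soft_T0 ::
    "'a set \<Rightarrow> ('e \<Rightarrow> 'a set) set \<Rightarrow> ('e \<Rightarrow> 'a set) set \<Rightarrow> 'e set \<Rightarrow> bool" where
  "pairwise_soft_T0 X T1 T2 E \<longleftrightarrow>
     bi_soft_topological_space X T1 T2 E \<and>
     (\<forall>x\<in>X. \<forall>y\<in>X. x \<noteq> y \<longrightarrow>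
        (\<exists>F\<in>T1 \<union> T2. (soft_mem E x F \<and> \<not> soft_mem E y F) \<or>
                     (soft_mem E y F \<and> \<not> soft_mem E x F)))"

definition param_opens :: "('e \<Rightarrow> 'a set) set \<Rightarrow> 'e \<Rightarrow> 'a set set" where
  "param_opens T e = {F e |F. F \<in> T}"

definition param_topology :: "('e \<Rightarrow> 'a set) set \<Rightarrow> 'e \<Rightarrow> 'a topology" where
  "param_topology T e = topology (\<lambda>U. U \<in> param_opens T e)"

definition bitopological_space :: "'a set \<Rightarrow> 'a topology \<Rightarrow> 'a topology \<Rightarrow> bool" where
  "bitopological_space X P Q \<longleftrightarrow> X \<noteq> {} \<and> topspace P = X \<and> topspace Q = X"

definition pairwise_T0 :: "'a set \<Rightarrow> 'a topology \<Rightarrow> 'a topology \<Rightarrow> bool" where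
  "pairwise_T0 X P Q \<longleftrightarrow>
     bitopological_space X P Q \<and>
     (\<forall>x\<in>X. \<forall>y\<in>X. x \<noteq> y \<longrightarrow>
        (\<exists>U. (openin P U \<or> openin Q U) \<and>
             ((x \<in> U \<and> y \<notin> U) \<or> (y \<in> U \<and> x \<notin> U))))"

(* The abstraction function "topology" is only meaningful on predicates satisfying
   istopology; the next lemmas show that param_topology is well defined. *)
lemma istopology_param_opens:
  assumes T: "soft_topology X E T" and e: "e \<in> E"
  shows "istopology (\<lambda>U. U \<in> param_opens T e)"
  unfolding istopology_def
proof (intro conjI allI impI)
  fix U V assume "U \<in> param_opens T e" "V \<in> param_opens T e"
  then obtain F G where "F \<in> T" "G \<in> T" "U = F e" "V = G e"
    by (auto simp: param_opens_def)
  moreover from this have "soft_inter E F G \<in> T"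
    using T by (auto simp: soft_topology_def)
  moreover have "soft_inter E F G e = F e \<inter> G e"
    using e by (simp add: soft_inter_def)
  ultimately show "U \<inter> V \<in> param_opens T e"
    unfolding param_opens_def by blast
next
  fix K assume K: "\<forall>U\<in>K. U \<in> param_opens T e"
  define S where "S = {F \<in> T. F e \<in> K}"
  have "soft_Union E S \<in> T"
    using T by (auto simp: soft_topology_def S_def)
  moreover have "soft_Union E S e = \<Union>K"
  proof -
    have "(\<lambda>F. F e) ` S = K"
      using K by (auto simp: S_def param_opens_def)
    then show ?thesis
      using e by (simp add: soft_Union_def)
  qed
  ultimately show "\<Union>K \<in> param_opens T e"
    unfolding param_opens_def by blast
qed

lemma openin_param_topology:
  assumes "soft_topology X E T" "e \<in> E"
  shows "openin (param_topology T e) U \<longleftrightarrow> U \<in> param_opens T e"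
  using istopology_param_opens[OF assms] by (simp add: param_topology_def)

lemma topspace_param_topology:
  assumes T: "soft_topology X E T" and e: "e \<in> E"
  shows "topspace (param_topology T e) = X"
proof -
  have "soft_absolute X E \<in> T" "soft_absolute X E e = X"
    using T e by (simp_all add: soft_topology_def soft_absolute_def)
  then have "X \<in> param_opens T e"
    unfolding param_opens_def by blast
  moreover have "U \<subseteq> X" if U: "U \<in> param_opens T e" for U
  proof -
    obtain F where "F \<in> T" "U = F e"
      using U unfolding param_opens_def by blast
    moreover from this have "F \<in> E \<rightarrow>\<^sub>E Pow X"
      using T unfolding soft_topology_def soft_sets_def by blast
    ultimately show ?thesis
      using PiE_mem e by blast
  qed
  ultimately show ?thesis
    unfolding topspace_def openin_param_topology[OF assms] by blast
qed

end

theory Submission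
  imports Defs
begin

text \<open>
  Membership in a soft complement demands exclusion at \<^emph>\<open>every\<close> parameter, whereas failure of
  soft membership is exclusion at \<^emph>\<open>some\<close> parameter. The hypothesis therefore separates two
  points at all parameters at once (\<open>soft_mem_compl_iff\<close>). As a parameter exists, this implies
  separation in the soft sense; and evaluating the separating soft set at any fixed parameter
  \<open>e\<close> gives a set that is open in one of the topologies at \<open>e\<close> and separates the same points.
\<close>

lemma soft_mem_compl_iff:
  "soft_mem E x (soft_compl X E F) \<longleftrightarrow> (\<forall>e\<in>E. x \<in> X \<and> x \<notin> F e)"
  by (simp add: soft_mem_def soft_compl_def)

text \<open>
  This fails for an empty parameter set, where every point belongs vacuously both to a soft set
  and to its complement.
\<close>

lemma soft_mem_compl_imp_not_soft_mem:
  assumes "E \<noteq> {}" and "soft_mem E x (soft_compl X E F)"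
  shows "\<not> soft_mem E x F"
  using assms unfolding soft_mem_compl_iff by (auto simp: soft_mem_def)

lemma openin_param_topology_value:
  assumes "soft_topology X E T" and "e \<in> E" and "F \<in> T"
  shows "openin (param_topology T e) (F e)"
  using assms by (auto simp: openin_param_topology param_opens_def)

theorem proposition5:
  fixes X :: "'a set" and E :: "'e set"
    and T1 T2 :: "('e \<Rightarrow> 'a set) set"
  assumes "X \<noteq> {}" and "E \<noteq> {}"
    and "bi_soft_topological_space X T1 T2 E"
    and "\<And>x y. x \<in> X \<Longrightarrow> y \<in> X \<Longrightarrow> x \<noteq> y \<Longrightarrow>
           (\<exists>F\<in>T1. soft_mem E x F \<and> soft_mem E y (soft_compl X E F)) \<or>
           (\<exists>G\<in>T2. soft_mem E y G \<and> soft_mem E x (soft_compl X E G))"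
  shows "pairwise_soft_T0 X T1 T2 E \<and>
         (\<forall>e\<in>E. pairwise_T0 X (param_topology T1 e) (param_topology T2 e))"
proof (intro conjI ballI)
  have T1: "soft_topology X E T1" and T2: "soft_topology X E T2"
    using assms(3) by (simp_all add: bi_soft_topological_space_def)
  \<comment> \<open>Both notions of \<open>T\<^sub>0\<close> are symmetric in the two topologies and in the two points, so it no
    longer matters which topology supplies the soft set or which point it contains.\<close>
  have separated: "\<exists>F\<in>T1 \<union> T2. (soft_mem E x F \<and> soft_mem E y (soft_compl X E F)) \<or>
                                (soft_mem E y F \<and> soft_mem E x (soft_compl X E F))"
    if "x \<in> X" "y \<in> X" "x \<noteq> y" for x y
    using assms(4)[OF that] by blast
  show "pairwise_soft_T0 X T1 T2 E"
    unfolding pairwise_soft_T0_def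
    using assms(3) separated soft_mem_compl_imp_not_soft_mem[OF assms(2)] by metis
  fix e assume e: "e \<in> E"
  have "\<exists>U. (openin (param_topology T1 e) U \<or> openin (param_topology T2 e) U) \<and>
            ((x \<in> U \<and> y \<notin> U) \<or> (y \<in> U \<and> x \<notin> U))"
    if xy: "x \<in> X" "y \<in> X" "x \<noteq> y" for x y
  proof -
    obtain F where F: "F \<in> T1 \<union> T2"
      and sep: "(soft_mem E x F \<and> soft_mem E y (soft_compl X E F)) \<or>
                (soft_mem E y F \<and> soft_mem E x (soft_compl X E F))"
      using separated[OF xy] by blast
    have "openin (param_topology T1 e) (F e) \<or> openin (param_topology T2 e) (F e)"
      using F openin_param_topology_value[OF T1 e] openin_param_topology_value[OF T2 e] by blast
    moreover have "(x \<in> F e \<and> y \<notin> F e) \<or> (y \<in> F e \<and> x \<notin> F e)"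
      using sep e unfolding soft_mem_compl_iff by (auto simp: soft_mem_def)
    ultimately show ?thesis
      by blast
  qed
  then show "pairwise_T0 X (param_topology T1 e) (param_topology T2 e)"
    using assms(1) topspace_param_topology[OF T1 e] topspace_param_topology[OF T2 e]
    by (simp add: pairwise_T0_def bitopological_space_def)
qed

end
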